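(* Let $\mathbb{F}_q$ be a finite field with $q=p^e$ elements, where $p$ is a prime number and $e>1$ is a positive integer. Let $\theta$ be a primitive element of $\mathbb{F}_q$, i.e., the order of $\theta$ in the multiplicative group of $\mathbb{F}_q$ is equal to $q-1$. Let $n\geq 3$ and let $i_1,i_2,\ldots,i_n$ be integers with $0\leq i_1<i_2<\cdots<i_n\leq q-2$. Let $$\mathcal{C}=\left\{\left(\lambda+\mu\theta^{i_1},\ \lambda+\mu\theta^{i_2},\ \ldots,\ \lambda+\mu\theta^{i_n}\right) : \lambda,\mu\in\mathbb{F}_q\right\}$$ be the two-dimensional Reed-Solomon code of length $n$ over $\mathbb{F}_q$ with code locators $\theta^{i_1},\ldots,\theta^{i_n}$. If (1) $i_{n-1}+i_n<e$, and (2) the number of elements of the set $\{i_j-i_k : 1\leq k<j\leq n\}$ is equal to $\frac{n(n-1)}{2}$, then the minimum insdel distance of $\mathcal{C}$ is equal to $2n-4$, i.e., $d(\mathcal{C})=2n-4$.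
   Context: For $\mathbf{a},\mathbf{b}\in\mathbb{F}_q^n$, the insdel distance $d(\mathbf{a},\mathbf{b})$ is the minimum number of insertions and deletions (of single symbols of $\mathbb{F}_q$) needed to transform $\mathbf{a}$ into $\mathbf{b}$. (It is a known fact that $d(\mathbf{a},\mathbf{b})=2n-2\ell$, where $\ell$ is the length of a longest common subsequence of $\mathbf{a}$ and $\mathbf{b}$.) The minimum insdel distance of a linear code $\mathcal{C}\subseteq\mathbb{F}_q^n$ is $d(\mathcal{C})=\min\{d(\mathbf{c}_1,\mathbf{c}_2) : \mathbf{c}_1,\mathbf{c}_2\in\mathcal{C},\ \mathbf{c}_1\neq\mathbf{c}_2\}$. *)

theory Defs
  imports
    "HOL-Algebra.Algebraic_Closure_Type"
    "HOL-Algebra.Multiplicative_Group"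
    "HOL-Computational_Algebra.Primes"
    "HOL-Library.Cardinality"
begin

(* units_of ring_of_type_algebra is the multiplicative group of the field 'a. The conjunct
   \<theta> \<noteq> 0 is needed because group.ord says nothing about elements outside the carrier. *)
definition primitive_element :: "'a :: {Fields.field, finite} \<Rightarrow> bool" where
  "primitive_element \<theta> \<longleftrightarrow>
     \<theta> \<noteq> 0 \<and> group.ord (units_of (ring_of_type_algebra :: 'a ring)) \<theta> = CARD('a) - 1"

(* Words are lists, since an insertion or a deletion changes the length. *)
inductive insdel_step :: "'a list \<Rightarrow> 'a list \<Rightarrow> bool" where
  insertion: "insdel_step (xs @ ys) (xs @ [x] @ ys)"
| deletion: "insdel_step (xs @ [x] @ ys) (xs @ ys)"

definition insdel_dist :: "'a list \<Rightarrow> 'a list \<Rightarrow> nat" where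
  "insdel_dist a b = (LEAST k. (insdel_step ^^ k) a b)"

(* On nat, Inf of a nonempty set is its least element; a code with fewer than two words
   gets the junk value 0. *)
definition min_insdel_dist :: "'a list set \<Rightarrow> nat" where
  "min_insdel_dist C = Inf {insdel_dist c1 c2 | c1 c2. c1 \<in> C \<and> c2 \<in> C \<and> c1 \<noteq> c2}"

definition rs_code2 :: "'a :: comm_ring_1 list \<Rightarrow> 'a list set" where
  "rs_code2 locs = {map (\<lambda>x. l + m * x) locs | l m. True}"

end

(* A common subsequence of length 3 of two distinct codewords yields an equation
   (x^a2 - x^a1) (x^b3 - x^b1) = (x^a3 - x^a1) (x^b2 - x^b1) at x = \<theta>, where a1 < a2 < a3 and
   b1 < b2 < b3 are exponents of the locators. Its degree is below e, which is the degree of \<theta>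
   over the prime field, so the two top terms cancel: a2 + b3 = a3 + b2. Since the differences of
   the exponents are distinct, the two codewords agree at two positions and are equal. Common
   subsequences of length 2 exist because the affine group is doubly transitive. *)

theory Submission
  imports Defs "HOL-Library.Sublist" "HOL-Number_Theory.Residues"
begin

section \<open>Insdel distance and common subsequences\<close>

text \<open>Only the letter of \<open>w\<close> matched with the deleted \<open>x\<close>, if there
  is one, has to be given up; the rest of the embedding survives.\<close>

lemma subseq_delete_one:
  assumes "subseq w (xs @ x # ys)"
  shows "\<exists>w'. subseq w' w \<and> subseq w' (xs @ ys) \<and> length w \<le> length w' + 1"
  using assms
proof (induction xs arbitrary: w)
  case Nil
  show ?case
  proof (cases w)
    case (Cons z w')
    \<comment> \<open>The first letter is dropped whether or not it is matched with
      \<open>x\<close>; the length bound leaves room for that.\<close>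
    then have "subseq w' ys"
      using Nil by (auto dest: subseq_Cons' split: if_splits)
    then show ?thesis
      using Cons by (intro exI[of _ w']) auto
  qed auto
next
  case (Cons a xs)
  show ?case
  proof (cases "subseq w (xs @ x # ys)")
    case True
    then obtain w' where "subseq w' w" "subseq w' (xs @ ys)" "length w \<le> length w' + 1"
      using Cons.IH by blast
    then show ?thesis by (intro exI[of _ w']) auto
  next
    case False
    obtain v where v: "w = a # v" "subseq v (xs @ x # ys)"
      using Cons.prems False unfolding append_Cons by (cases rule: list_emb.cases) auto
    obtain w' where "subseq w' v" "subseq w' (xs @ ys)" "length v \<le> length w' + 1"
      using Cons.IH[OF v(2)] by blast
    then show ?thesis using v by (intro exI[of _ "a # w'"]) auto
  qed
qed

text \<open>Invariant along an edit sequence: an insertion lengthens \<open>b\<close> by one and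
  keeps \<open>w\<close>, while a deletion shortens \<open>b\<close> by one and costs
  \<open>w\<close> at most one letter. In both cases the extra step pays for the change.\<close>

lemma insdel_steps_imp_common_subseq:
  "(insdel_step ^^ k) a b \<Longrightarrow>
    \<exists>w. subseq w a \<and> subseq w b \<and> length a + length b \<le> 2 * length w + k"
proof (induction k arbitrary: b)
  case 0
  then show ?case by (intro exI[of _ a]) auto
next
  case (Suc k)
  then obtain y where y: "(insdel_step ^^ k) a y" "insdel_step y b" by auto
  obtain w where w: "subseq w a" "subseq w y" "length a + length y \<le> 2 * length w + k"
    using Suc.IH[OF y(1)] by blast
  from y(2) show ?case
  proof cases
    case (insertion xs ys x)
    have "subseq (xs @ ys) (xs @ [x] @ ys)"
      by (intro list_emb_append_mono list_emb_append2) auto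
    then have "subseq w b"
      using w(2) insertion subseq_order.order_trans by blast
    then show ?thesis using w insertion by (intro exI[of _ w]) auto
  next
    case (deletion xs x ys)
    then obtain w' where "subseq w' w" "subseq w' b" "length w \<le> length w' + 1"
      using subseq_delete_one[of w xs x ys] w(2) by auto
    moreover from this have "subseq w' a"
      using w(1) subseq_order.order_trans by blast
    ultimately show ?thesis using w deletion by (intro exI[of _ w']) auto
  qed
qed

section \<open>Edit sequences built from common subsequences\<close>

lemma insdel_step_Cons: "insdel_step a b \<Longrightarrow> insdel_step (x # a) (x # b)"
  by (induction rule: insdel_step.induct) (metis append_Cons insdel_step.intros)+

lemma insdel_steps_Cons: "(insdel_step ^^ k) a b \<Longrightarrow> (insdel_step ^^ k) (x # a) (x # b)"
  by (induction k arbitrary: b) (auto intro: insdel_step_Cons relcomppI)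

lemma insdel_step_sym: "insdel_step a b \<Longrightarrow> insdel_step b a"
  by (induction rule: insdel_step.induct) (rule insdel_step.intros)+

lemma subseq_imp_insdel_steps:
  "subseq w a \<Longrightarrow> (insdel_step ^^ (length a - length w)) w a"
proof (induction rule: list_emb.induct)
  case (list_emb_Nil ys)
  show ?case
  proof (induction ys)
    case (Cons y ys)
    have "insdel_step ys (y # ys)"
      using insdel_step.insertion[of "[]" ys y] by simp
    with Cons show ?case by auto
  qed auto
next
  case (list_emb_Cons xs ys y)
  have "insdel_step ys (y # ys)"
    using insdel_step.insertion[of "[]" ys y] by simp
  moreover have "length (y # ys) - length xs = Suc (length ys - length xs)"
    using list_emb_length[OF list_emb_Cons.hyps] by simp
  ultimately show ?case using list_emb_Cons.IH by auto
next
  case (list_emb_Cons2 x y xs ys)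
  then show ?case using insdel_steps_Cons by auto
qed

lemma insdel_steps_sym: "(insdel_step ^^ k) a b \<Longrightarrow> (insdel_step ^^ k) b a"
proof (induction k arbitrary: b)
  case (Suc k)
  then obtain y where "(insdel_step ^^ k) a y" "insdel_step y b" by auto
  with Suc.IH show ?case
    by (metis insdel_step_sym relpowp_Suc_I2)
qed auto

text \<open>The path runs through \<open>w\<close>: delete from \<open>a\<close> the letters outside
  \<open>w\<close>, then insert the missing letters of \<open>b\<close>. The first half is a
  reversed insertion path.\<close>

lemma common_subseq_imp_insdel_steps:
  assumes "subseq w a" "subseq w b"
  shows "(insdel_step ^^ (length a + length b - 2 * length w)) a b"
proof -
  have "(insdel_step ^^ ((length a - length w) + (length b - length w))) a b"
    unfolding relpowp_add
    using assms by (blast intro: subseq_imp_insdel_steps insdel_steps_sym)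
  moreover have "(length a - length w) + (length b - length w) = length a + length b - 2 * length w"
    using list_emb_length[OF assms(1)] list_emb_length[OF assms(2)] by simp
  ultimately show ?thesis by metis
qed

lemma insdel_dist_le:
  assumes "subseq w a" "subseq w b"
  shows "insdel_dist a b \<le> length a + length b - 2 * length w"
  unfolding insdel_dist_def by (rule Least_le, rule common_subseq_imp_insdel_steps[OF assms])

lemma insdel_dist_ge:
  assumes "\<And>w. subseq w a \<Longrightarrow> subseq w b \<Longrightarrow> length w \<le> l"
  shows "length a + length b - 2 * l \<le> insdel_dist a b"
proof -
  \<comment> \<open>The \<open>LEAST\<close> is attained because some edit sequence exists: the
    empty word is always a common subsequence.\<close>
  have "(insdel_step ^^ insdel_dist a b) a b"
    unfolding insdel_dist_def
    by (rule LeastI, rule common_subseq_imp_insdel_steps[of "[]"]) auto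
  from insdel_steps_imp_common_subseq[OF this] obtain w where
    w: "subseq w a" "subseq w b" "length a + length b \<le> 2 * length w + insdel_dist a b" by blast
  then show ?thesis using assms[of w] by linarith
qed

lemma subseq_length_3_nth:
  assumes "subseq (x # y # z # w) xs"
  shows "\<exists>j1 j2 j3. j1 < j2 \<and> j2 < j3 \<and> j3 < length xs \<and> xs ! j1 = x \<and> xs ! j2 = y \<and> xs ! j3 = z"
proof -
  obtain us vs where 1: "xs = us @ x # vs" "subseq (y # z # w) vs"
    using list_emb_ConsD[OF assms] by auto
  obtain us' vs' where 2: "vs = us' @ y # vs'" "subseq (z # w) vs'"
    using list_emb_ConsD[OF 1(2)] by auto
  obtain us'' vs'' where 3: "vs' = us'' @ z # vs''"
    using list_emb_ConsD[OF 2(2)] by auto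
  show ?thesis unfolding 1 2 3
    by (rule exI[of _ "length us"], rule exI[of _ "length us + Suc (length us')"],
        rule exI[of _ "length us + Suc (length us') + Suc (length us'')"])
       (simp add: nth_append)
qed

section \<open>The degree of a primitive element\<close>

text \<open>Powers below the order of a group element are distinct; the rest of the proof carries
  this from the unit group over to the type class operations.\<close>

lemma primitive_element_pow_inj:
  fixes \<theta> :: "'a :: {Fields.field, finite}"
  assumes "primitive_element \<theta>"
  shows "inj_on (\<lambda>k. \<theta> ^ k) {0..CARD('a) - 2}"
proof -
  let ?R = "ring_of_type_algebra :: 'a ring"
  interpret R: field ?R by rule
  interpret G: group "units_of ?R" by (rule R.units_group)
  have "carrier (units_of ?R) = UNIV - {0}"
    by (simp add: units_of_carrier R.field_Units) (simp add: ring_of_type_algebra_def)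
  then have "\<theta> \<in> carrier (units_of ?R)"
    using assms by (simp add: primitive_element_def)
  from G.ord_inj[OF this] have "inj_on (\<lambda>k. \<theta> [^]\<^bsub>units_of ?R\<^esub> k) {0..CARD('a) - 2}"
    using assms by (simp add: primitive_element_def numeral_2_eq_2)
  moreover have "\<theta> [^]\<^bsub>units_of ?R\<^esub> k = \<theta> ^ k" for k :: nat
    by (induction k)
       (simp_all add: units_of_one units_of_mult ring_of_type_algebra_def mult.commute)
  ultimately show ?thesis by simp
qed

lemma primitive_element_pow_surj:
  fixes \<theta> x :: "'a :: {Fields.field, finite}"
  assumes "primitive_element \<theta>" "x \<noteq> 0"
  shows "\<exists>k. x = \<theta> ^ k"
proof -
  \<comment> \<open>With at least two field elements, the truncated \<open>CARD('a) - 2\<close> is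
    exact and the interval has \<open>CARD('a) - 1\<close> members, as many as there are nonzero
    elements.\<close>
  have "card {0::'a, 1} \<le> CARD('a)" by (rule card_mono) auto
  then have "card ((\<lambda>k. \<theta> ^ k) ` {0..CARD('a) - 2}) = card (UNIV - {0::'a})"
    by (simp add: card_image[OF primitive_element_pow_inj[OF assms(1)]] card_Diff_singleton)
  moreover have "(\<lambda>k. \<theta> ^ k) ` {0..CARD('a) - 2} \<subseteq> UNIV - {0}"
    using assms(1) by (auto simp: primitive_element_def)
  ultimately have "(\<lambda>k. \<theta> ^ k) ` {0..CARD('a) - 2} = UNIV - {0}"
    by (intro card_subset_eq) auto
  then show ?thesis using assms(2) by blast
qed

text \<open>In a field of characteristic p the integers map onto the prime field, so this is the
  span of 1, x, ..., x^(d-1) over the prime field, expressed without a subfield.\<close>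

definition int_span_powers :: "'a :: comm_ring_1 \<Rightarrow> nat \<Rightarrow> 'a set" where
  "int_span_powers x d = {\<Sum>k<d. of_int (c k) * x ^ k | c. True}"

lemma int_span_powers_I:
  "u = (\<Sum>k<d. of_int (c k) * x ^ k) \<Longrightarrow> u \<in> int_span_powers x d"
  by (auto simp: int_span_powers_def)

lemma int_span_powers_0: "0 \<in> int_span_powers x d"
  by (rule int_span_powers_I[of _ "\<lambda>_. 0"]) simp

lemma int_span_powers_add:
  assumes "u \<in> int_span_powers x d" "v \<in> int_span_powers x d"
  shows "u + v \<in> int_span_powers x d"
proof -
  obtain c c' where "u = (\<Sum>k<d. of_int (c k) * x ^ k)" "v = (\<Sum>k<d. of_int (c' k) * x ^ k)"
    using assms by (auto simp: int_span_powers_def)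
  then have "u + v = (\<Sum>k<d. of_int (c k + c' k) * x ^ k)"
    by (simp add: sum.distrib algebra_simps)
  then show ?thesis by (rule int_span_powers_I)
qed

lemma int_span_powers_smult:
  assumes "u \<in> int_span_powers x d"
  shows "of_int m * u \<in> int_span_powers x d"
proof -
  obtain c where "u = (\<Sum>k<d. of_int (c k) * x ^ k)"
    using assms by (auto simp: int_span_powers_def)
  then have "of_int m * u = (\<Sum>k<d. of_int (m * c k) * x ^ k)"
    by (simp add: sum_distrib_left algebra_simps)
  then show ?thesis by (rule int_span_powers_I)
qed

lemma int_span_powers_diff:
  assumes "u \<in> int_span_powers x d" "v \<in> int_span_powers x d"
  shows "u - v \<in> int_span_powers x d"
  using int_span_powers_add[OF assms(1) int_span_powers_smult[OF assms(2), of "- 1"]] by simp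

lemma int_span_powers_sum:
  "(\<And>k. k \<in> A \<Longrightarrow> f k \<in> int_span_powers x d) \<Longrightarrow> sum f A \<in> int_span_powers x d"
  by (induction A rule: infinite_finite_induct)
     (auto intro: int_span_powers_0 int_span_powers_add)

lemma int_span_powers_power:
  assumes "k < d"
  shows "x ^ k \<in> int_span_powers x d"
proof -
  have "(\<Sum>j<d. of_int (if j = k then 1 else 0) * x ^ j) = (\<Sum>j<d. if j = k then x ^ j else 0)"
    by (intro sum.cong) auto
  also have "\<dots> = x ^ k" using assms by simp
  finally show ?thesis by (rule int_span_powers_I[OF sym])
qed

text \<open>Multiplication by \<open>x\<close> shifts every exponent by one. Only the top power can
  leave the range, and the assumption brings it back.\<close>

lemma int_span_powers_all_powers:
  assumes "x ^ d \<in> int_span_powers x d"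
  shows "x ^ m \<in> int_span_powers x d"
proof (induction m)
  \<comment> \<open>For \<open>d = 0\<close> the span is {0} and the claim about
    \<open>x ^ 0\<close> is the assumption itself.\<close>
  case 0
  then show ?case
    using assms int_span_powers_power[of 0 d x] by (cases d) auto
next
  case (Suc m)
  then obtain c where c: "x ^ m = (\<Sum>k<d. of_int (c k) * x ^ k)"
    by (auto simp: int_span_powers_def)
  have "x ^ Suc m = (\<Sum>k<d. of_int (c k) * x ^ Suc k)"
    unfolding power_Suc c by (simp add: sum_distrib_left algebra_simps)
  moreover have "x ^ Suc k \<in> int_span_powers x d" if "k < d" for k
    using that assms int_span_powers_power[of "Suc k" d x] by (cases "Suc k = d") auto
  ultimately show ?case
    by (auto intro!: int_span_powers_sum int_span_powers_smult simp del: power_Suc)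
qed

text \<open>Coefficients matter only modulo \<open>p\<close>, which leaves \<open>p ^ d\<close>
  coefficient vectors.\<close>

lemma card_int_span_powers_le:
  fixes x :: "'a :: {comm_ring_1, finite}"
  assumes "of_nat p = (0 :: 'a)" "p > 0"
  shows "card (int_span_powers x d) \<le> p ^ d"
proof -
  let ?E = "{..<d} \<rightarrow>\<^sub>E {0..<int p}"
  let ?g = "\<lambda>c. \<Sum>k<d. of_int (c k) * x ^ k"
  have red: "(of_int (m mod int p) :: 'a) = of_int m" for m
  proof -
    have "(of_int m :: 'a) = of_int (int p * (m div int p) + m mod int p)" by simp
    also have "\<dots> = of_int (m mod int p)"
      unfolding of_int_add of_int_mult using assms(1) by simp
    finally show ?thesis by simp
  qed
  have "int_span_powers x d \<subseteq> ?g ` ?E"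
  proof
    fix u assume "u \<in> int_span_powers x d"
    then obtain c where c: "u = ?g c" by (auto simp: int_span_powers_def)
    have "?g (restrict (\<lambda>k. c k mod int p) {..<d}) = u"
      unfolding c by (intro sum.cong) (auto simp: red)
    moreover have "restrict (\<lambda>k. c k mod int p) {..<d} \<in> ?E"
      using assms(2) by auto
    ultimately show "u \<in> ?g ` ?E" by blast
  qed
  then have "card (int_span_powers x d) \<le> card ?E"
    by (meson surj_card_le finite_PiE finite_lessThan finite_atLeastLessThan_int)
  then show ?thesis by (simp add: card_PiE)
qed

text \<open>Otherwise the span would contain all powers of \<open>\<theta>\<close>, hence the whole
  field, and \<open>p ^ e\<close> elements do not fit into a set of at most
  \<open>p ^ d\<close>.\<close>

lemma primitive_element_pow_notin_span:
  fixes \<theta> :: "'a :: {Fields.field, finite}"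
  assumes "primitive_element \<theta>" "CARD('a) = p ^ e" "p > 1" "d < e"
  shows "\<theta> ^ d \<notin> int_span_powers \<theta> d"
proof
  assume *: "\<theta> ^ d \<in> int_span_powers \<theta> d"
  have "x \<in> int_span_powers \<theta> d" for x
    using primitive_element_pow_surj[OF assms(1), of x] int_span_powers_all_powers[OF *]
      int_span_powers_0 by blast
  then have U: "int_span_powers \<theta> d = UNIV" by auto
  \<comment> \<open>The characteristic divides the number of elements; a field has no nilpotents, so
    \<open>p\<close> itself vanishes.\<close>
  have "(of_nat (p ^ e) :: 'a) = 0"
    using CHAR_dvd_CARD[where 'a = 'a] assms(2) by (simp only: of_nat_eq_0_iff_char_dvd)
  then have "(of_nat p :: 'a) = 0" by (simp del: of_nat_eq_0_iff)
  from card_int_span_powers_le[OF this, of \<theta> d] have "p ^ e \<le> p ^ d"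
    using U assms by simp
  then show False using assms by simp
qed

text \<open>After expansion the terms with exponent \<open>a1 + b1\<close> cancel, and each of the
  other four small exponents lies below \<open>a2 + b3\<close> or \<open>a3 + b2\<close>. If these
  two differed, the larger power would be an integer combination of lower ones.\<close>

lemma top_terms_cancel:
  fixes \<theta> :: "'a :: {Fields.field, finite}"
  assumes \<theta>: "primitive_element \<theta>" "CARD('a) = p ^ e" "p > 1"
    and a: "a1 < a2" "a2 < a3" and b: "b1 < b2" "b2 < b3"
    and deg: "a2 + b3 < e" "a3 + b2 < e"
    and eq: "(\<theta> ^ a2 - \<theta> ^ a1) * (\<theta> ^ b3 - \<theta> ^ b1) = (\<theta> ^ a3 - \<theta> ^ a1) * (\<theta> ^ b2 - \<theta> ^ b1)"
  shows "a2 + b3 = a3 + b2"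
proof (rule linorder_cases[of "a2 + b3" "a3 + b2"])
  assume lt: "a2 + b3 < a3 + b2"
  have "\<theta> ^ (a3 + b2) = \<theta> ^ (a2 + b3) + \<theta> ^ (a3 + b1) + \<theta> ^ (a1 + b2)
      - \<theta> ^ (a2 + b1) - \<theta> ^ (a1 + b3)"
    using eq by (simp add: power_add algebra_simps)
  also have "\<dots> \<in> int_span_powers \<theta> (a3 + b2)"
    using lt a b by (intro int_span_powers_diff int_span_powers_add int_span_powers_power) auto
  finally show ?thesis
    using primitive_element_pow_notin_span[OF \<theta> deg(2)] by blast
next
  assume lt: "a3 + b2 < a2 + b3"
  have "\<theta> ^ (a2 + b3) = \<theta> ^ (a2 + b1) + \<theta> ^ (a1 + b3) + \<theta> ^ (a3 + b2)
      - \<theta> ^ (a3 + b1) - \<theta> ^ (a1 + b2)"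
    using eq by (simp add: power_add algebra_simps)
  also have "\<dots> \<in> int_span_powers \<theta> (a2 + b3)"
    using lt a b by (intro int_span_powers_diff int_span_powers_add int_span_powers_power) auto
  finally show ?thesis
    using primitive_element_pow_notin_span[OF \<theta> deg(1)] by blast
qed

section \<open>Two-dimensional Reed-Solomon codes\<close>

lemma affine_agree_twice_eq:
  fixes l m l' m' x y :: "'a :: Fields.field"
  assumes "l + m * x = l' + m' * x" "l + m * y = l' + m' * y" "x \<noteq> y"
  shows "l = l' \<and> m = m'"
proof -
  have "(m - m') * (x - y) = (l + m * x - (l' + m' * x)) - (l + m * y - (l' + m' * y))"
    by (simp add: algebra_simps)
  then have "(m - m') * (x - y) = 0" using assms(1,2) by simp
  then show ?thesis using assms by simp
qed

text \<open>Subtracting the first match from the other two removes \<open>l\<close> and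
  \<open>l'\<close>; cross-multiplying the two results leaves the common factor
  \<open>m * m'\<close>.\<close>

lemma affine_match_cross_ratio:
  fixes l m l' m' :: "'a :: Fields.field"
  assumes "l + m * x1 = l' + m' * y1" "l + m * x2 = l' + m' * y2" "l + m * x3 = l' + m' * y3"
    and "x1 \<noteq> x2" "y1 \<noteq> y2"
    and "(l, m) \<noteq> (l', m')"
  shows "(x2 - x1) * (y3 - y1) = (x3 - x1) * (y2 - y1)"
proof -
  have diff: "m * (s - x1) = m' * (t - y1)" if "l + m * s = l' + m' * t" for s t
  proof -
    have "m * (s - x1) = (l + m * s) - (l + m * x1)" by (simp add: algebra_simps)
    also have "\<dots> = m' * (t - y1)" unfolding that assms(1) by (simp add: algebra_simps)
    finally show ?thesis .
  qed
  note d2 = diff[OF assms(2)] and d3 = diff[OF assms(3)]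
  \<comment> \<open>By \<open>d2\<close>, if one slope is zero then so is the other, and the first
    match then forces \<open>l = l'\<close>.\<close>
  have "m \<noteq> 0 \<and> m' \<noteq> 0" using d2 assms(1,4-6) by auto
  moreover have "(m * (x2 - x1)) * (m' * (y3 - y1)) = (m * (x3 - x1)) * (m' * (y2 - y1))"
    unfolding d2 d3 by simp
  then have "(m * m') * ((x2 - x1) * (y3 - y1)) = (m * m') * ((x3 - x1) * (y2 - y1))"
    by (simp only: ac_simps)
  ultimately show ?thesis by simp
qed

lemma rs_code2_length_2_common_subseq:
  fixes locs :: "'a :: Fields.field list"
  assumes "distinct locs" "length locs \<ge> 3"
  shows "\<exists>c1 c2 w. c1 \<in> rs_code2 locs \<and> c2 \<in> rs_code2 locs \<and> c1 \<noteq> c2 \<and>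
    subseq w c1 \<and> subseq w c2 \<and> length w = 2"
proof -
  obtain x y z r where L: "locs = x # y # z # r"
    using assms(2) by (metis Suc_le_length_iff numeral_3_eq_3)
  then have d: "x \<noteq> y" "y \<noteq> z" using assms(1) by auto
  \<comment> \<open>The affine map sends y to x and z to y, so its codeword carries x, y one place
    later than \<open>locs\<close> does. The second entries, x and y, tell the two words
    apart.\<close>
  define m where "m = (x - y) / (y - z)"
  define l where "l = x - m * y"
  have f: "l + m * y = x" "l + m * z = y"
    using d by (simp_all add: l_def m_def divide_simps) (simp add: algebra_simps)
  let ?c = "map (\<lambda>t. l + m * t) locs"
  have "locs = map (\<lambda>t. 0 + 1 * t) locs" by simp
  then have "locs \<in> rs_code2 locs" unfolding rs_code2_def by blast
  moreover have "?c \<in> rs_code2 locs" by (auto simp: rs_code2_def)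
  moreover have "locs \<noteq> ?c" using L f d by auto
  moreover have "subseq [x, y] locs" using L by simp
  moreover have "subseq [x, y] ?c" using L f by (simp add: list_emb_Cons)
  ultimately show ?thesis
    by (intro exI[of _ locs] exI[of _ ?c] exI[of _ "[x, y]"]) simp
qed

section \<open>Injectivity of the exponent differences\<close>

lemma card_increasing_pairs:
  "card {(j, k). 1 \<le> k \<and> k < j \<and> j \<le> (n::nat)} = n * (n - 1) div 2"
proof -
  have "{(j, k). 1 \<le> k \<and> k < j \<and> j \<le> n} = (SIGMA j : {..n}. {1..<j})" by auto
  \<comment> \<open>At \<open>j = 0\<close> the truncated \<open>j - 1\<close> agrees with the empty
    range \<open>{1..<0}\<close>.\<close>
  then have "card {(j, k). 1 \<le> k \<and> k < j \<and> j \<le> n} = (\<Sum>j\<le>n. j - 1)" by simp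
  also have "\<dots> = n * (n - 1) div 2"
  proof (induction n)
    case (Suc n)
    then show ?case by (cases n) auto
  qed simp
  finally show ?thesis .
qed

lemma image_Collect_pairs: "(\<lambda>(x, y). f x y) ` {(x, y). P x y} = {f x y | x y. P x y}"
  by auto

text \<open>There are as many differences as pairs, so the difference map is injective on the finite
  set of pairs. The equation between sums is equality of differences without subtraction on
  naturals.\<close>

lemma differences_inj:
  fixes i :: "nat \<Rightarrow> nat"
  assumes card: "card {int (i j) - int (i k) | j k. 1 \<le> k \<and> k < j \<and> j \<le> n} = n * (n - 1) div 2"
    and "1 \<le> k" "k < j" "j \<le> n" "1 \<le> k'" "k' < j'" "j' \<le> n"
    and "i j + i k' = i j' + i k"
  shows "j = j' \<and> k = k'"
proof -
  let ?T = "{(j, k). 1 \<le> k \<and> k < j \<and> j \<le> n}"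
  let ?f = "\<lambda>(j, k). int (i j) - int (i k)"
  have "?T \<subseteq> {..n} \<times> {..n}" by auto
  then have fin: "finite ?T" by (rule finite_subset) auto
  have "?f ` ?T = {int (i j) - int (i k) | j k. 1 \<le> k \<and> k < j \<and> j \<le> n}"
    by (rule image_Collect_pairs)
  then have "card (?f ` ?T) = card ?T"
    unfolding card_increasing_pairs using card by (rule ssubst)
  then have "inj_on ?f ?T" by (rule eq_card_imp_inj_on[OF fin])
  from inj_onD[OF this, of "(j, k)" "(j', k')"] show ?thesis using assms by auto
qed

section \<open>The minimum distance of the code\<close>

theorem theoremB:
  fixes p e n :: nat
    and \<theta> :: "'a :: {Fields.field, finite}"
    and i :: "nat \<Rightarrow> nat"
  assumes "Factorial_Ring.prime p" and "e > 1" and "CARD('a) = p ^ e"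
    and "primitive_element \<theta>"
    and "n \<ge> 3"
    and "strict_mono_on {1..n} i" and "i n \<le> CARD('a) - 2"
    and "i (n - 1) + i n < e"
    and "card {int (i j) - int (i k) | j k. 1 \<le> k \<and> k < j \<and> j \<le> n} = n * (n - 1) div 2"
  shows "min_insdel_dist (rs_code2 (map (\<lambda>j. \<theta> ^ i j) [1..<n + 1])) = 2 * n - 4"
proof -
  define locs where "locs = map (\<lambda>j. \<theta> ^ i j) [1..<n + 1]"
  have len: "length locs = n" by (simp add: locs_def)
  have nth: "locs ! j = \<theta> ^ i (Suc j)" if "j < n" for j
    using that by (simp add: locs_def del: upt_Suc)
  have p: "p > 1" using assms(1) prime_gt_1_nat by blast
  have less: "i j < i k" if "1 \<le> j" "j < k" "k \<le> n" for j k
    using strict_mono_onD[OF assms(6), of j k] that by auto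
  then have le: "i j \<le> i k" if "1 \<le> j" "j \<le> k" "k \<le> n" for j k
    using that by (cases "j = k") (auto intro: less_imp_le)
  \<comment> \<open>All exponents are at most \<open>i n\<close>, hence within the range where
    powers are injective.\<close>
  have neq: "\<theta> ^ i j \<noteq> \<theta> ^ i k" if "1 \<le> j" "j < k" "k \<le> n" for j k
    using inj_onD[OF primitive_element_pow_inj[OF assms(4)], of "i j" "i k"]
      less[OF that] le[of j n] le[of k n] that assms(7) by auto
  have dist: "distinct locs"
    unfolding distinct_conv_nth len
  proof (intro allI impI)
    fix j k assume "j < n" "k < n" "j \<noteq> k"
    then show "locs ! j \<noteq> locs ! k"
      using neq[of "Suc j" "Suc k"] neq[of "Suc k" "Suc j"] nth
      by (cases "j < k") auto
  qed
  have no3: "length w \<le> 2"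
    if c12: "c1 \<in> rs_code2 locs" "c2 \<in> rs_code2 locs" "c1 \<noteq> c2"
      and sub: "subseq w c1" "subseq w c2" for c1 c2 w
  proof (rule ccontr)
    assume "\<not> length w \<le> 2"
    then obtain x y z w' where w: "w = x # y # z # w'"
      by (metis Suc_le_length_iff not_less_eq_eq numeral_2_eq_2)
    obtain l m l' m' where c: "c1 = map (\<lambda>x. l + m * x) locs" "c2 = map (\<lambda>x. l' + m' * x) locs"
      using c12 by (auto simp: rs_code2_def)
    have ne: "(l, m) \<noteq> (l', m')" using c c12(3) by auto
    obtain j1 j2 j3 where j: "j1 < j2" "j2 < j3" "j3 < n"
        "c1 ! j1 = x" "c1 ! j2 = y" "c1 ! j3 = z"
      using subseq_length_3_nth[of x y z w' c1] sub(1) w c(1) len by auto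
    obtain k1 k2 k3 where k: "k1 < k2" "k2 < k3" "k3 < n"
        "c2 ! k1 = x" "c2 ! k2 = y" "c2 ! k3 = z"
      using subseq_length_3_nth[of x y z w' c2] sub(2) w c(2) len by auto
    let ?a1 = "i (Suc j1)" and ?a2 = "i (Suc j2)" and ?a3 = "i (Suc j3)"
    let ?b1 = "i (Suc k1)" and ?b2 = "i (Suc k2)" and ?b3 = "i (Suc k3)"
    have eqs: "l + m * \<theta> ^ ?a1 = l' + m' * \<theta> ^ ?b1" "l + m * \<theta> ^ ?a2 = l' + m' * \<theta> ^ ?b2"
        "l + m * \<theta> ^ ?a3 = l' + m' * \<theta> ^ ?b3"
      using j k c len by (simp_all add: nth[symmetric])
    have "(\<theta> ^ ?a2 - \<theta> ^ ?a1) * (\<theta> ^ ?b3 - \<theta> ^ ?b1) = (\<theta> ^ ?a3 - \<theta> ^ ?a1) * (\<theta> ^ ?b2 - \<theta> ^ ?b1)"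
      by (rule affine_match_cross_ratio[OF eqs _ _ ne])
        (use j k neq[of "Suc j1" "Suc j2"] neq[of "Suc k1" "Suc k2"] in auto)
    \<comment> \<open>Positions count from 0 and locators from 1. The middle index lies below a
      third one, so it is at most \<open>n - 1\<close>; both top exponents are then at most
      \<open>i (n - 1) + i n\<close>, below \<open>e\<close>.\<close>
    moreover have "?a2 \<le> i (n - 1)" "?b2 \<le> i (n - 1)" "?a3 \<le> i n" "?b3 \<le> i n"
      using j k by (auto intro!: le)
    moreover have "?a1 < ?a2" "?a2 < ?a3" "?b1 < ?b2" "?b2 < ?b3"
      using j k by (auto intro!: less)
    ultimately have "?a2 + ?b3 = ?a3 + ?b2"
      using assms(8) by (intro top_terms_cancel[OF assms(4,3) p]) auto
    \<comment> \<open>The equation says that the last two matched exponents have the same difference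
      in both words.\<close>
    then have jk: "j3 = k3" "j2 = k2"
      using differences_inj[OF assms(9), of "Suc j2" "Suc j3" "Suc k2" "Suc k3"] j k by auto
    then show False
      using affine_agree_twice_eq[OF eqs(2,3)[folded jk]] neq[of "Suc j2" "Suc j3"] j ne by simp
  qed
  have ge: "2 * n - 4 \<le> insdel_dist c1 c2"
    if "c1 \<in> rs_code2 locs" "c2 \<in> rs_code2 locs" "c1 \<noteq> c2" for c1 c2
  proof -
    have "length c1 = n" "length c2 = n"
      using that(1,2) len by (auto simp: rs_code2_def)
    then show ?thesis using insdel_dist_ge[of c1 c2 2] no3[OF that] by (simp add: mult_2)
  qed
  obtain c1 c2 w where w: "c1 \<in> rs_code2 locs" "c2 \<in> rs_code2 locs" "c1 \<noteq> c2"
      "subseq w c1" "subseq w c2" "length w = 2"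
    using rs_code2_length_2_common_subseq[OF dist] len assms(5) by auto
  moreover have "length c1 = n" "length c2 = n"
    using w(1,2) len by (auto simp: rs_code2_def)
  ultimately have "insdel_dist c1 c2 = 2 * n - 4"
    using insdel_dist_le[OF w(4,5)] ge[OF w(1-3)] by (simp add: mult_2)
  \<comment> \<open>The value \<open>2 * n - 4\<close> is a lower bound that is attained, so
    \<open>Inf\<close> is taken over a nonempty set and is a true minimum.\<close>
  then have "min_insdel_dist (rs_code2 locs) = 2 * n - 4"
    unfolding min_insdel_dist_def using w(1-3) ge
    by (intro cInf_eq_minimum) (auto, metis)
  then show ?thesis unfolding locs_def .
qed

end
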